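(* Let $s \ge 2$ be a fixed integer (constant, independent of $n$), and for $n>s$ let $Y=Y_{n,s}$ be the number of draws needed to collect all $n$ coupons when each draw is an independent, uniformly random $s$-subset of the $n$ coupons. Then, as $n\to\infty$, $$\mathbb{E}[Y] = \frac{n}{s}\, H_{n} -\frac{s-1}{2s}\, H_{n} + O(1),$$ where $H_n=\sum_{j=1}^n \frac1j$.
   Context: Coupon collector's problem with group drawings: there are $n$ distinct coupons. At each step (draw) $k=1,2,3,\ldots$ one obtains a package, which is a set of $s$ distinct coupons ($1\le s\le n-1$), chosen uniformly at random among all $\binom{n}{s}$ subsets of size $s$, independently of the other draws. $Y_{n,s}$ is the (random) smallest number of draws after which every one of the $n$ coupons has appeared in at least one drawn package. $H_n = 1+\frac12+\cdots+\frac1n$ is the $n$-th harmonic number. The implied constant in $O(1)$ may depend on the fixed $s$. *)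

theory Defs
  imports "HOL-Probability.Probability"
begin

definition packages :: "nat \<Rightarrow> nat \<Rightarrow> nat set set" where
  "packages n s = {A. A \<subseteq> {1..n} \<and> card A = s}"

text \<open>Draws are numbered from 1, so \<open>X k\<close> is only constrained for \<open>k \<ge> 1\<close>.\<close>

locale coupon_collector = prob_space M
  for M :: "'a measure" and X :: "nat \<Rightarrow> 'a \<Rightarrow> nat set" and n s :: nat +
  assumes s_ge_1: "1 \<le> s" and s_less_n: "s < n"
    and indep_draws: "indep_vars (\<lambda>_. count_space (packages n s)) X {1..}"
    and uniform_draws:
      "k \<ge> 1 \<Longrightarrow> distr M (count_space (packages n s)) (X k) = uniform_count_measure (packages n s)"

text \<open>The value is \<open>\<infinity>\<close> on outcomes where some coupon is never drawn (the infimum of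
  the empty set in \<^typ>\<open>enat\<close>).\<close>

definition draws_needed :: "(nat \<Rightarrow> 'a \<Rightarrow> nat set) \<Rightarrow> nat \<Rightarrow> 'a \<Rightarrow> enat" where
  "draws_needed X n \<omega> = (INF m \<in> {m. (\<Union>k\<in>{1..m}. X k \<omega>) = {1..n}}. enat m)"

text \<open>The expectation of the extended-natural-valued variable, so that no finiteness or
  integrability is presupposed.\<close>

definition expected_draws :: "'a measure \<Rightarrow> (nat \<Rightarrow> 'a \<Rightarrow> nat set) \<Rightarrow> nat \<Rightarrow> ennreal" where
  "expected_draws M X n = (\<integral>\<^sup>+ \<omega>. ennreal_of_enat (draws_needed X n \<omega>) \<partial>M)"

text \<open>The locale is inhabited, by the canonical model on sequences of packages.\<close>

lemma coupon_collector_canonical: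
  assumes "1 \<le> s" "s < n"
  shows "coupon_collector (PiM UNIV (\<lambda>_::nat. uniform_count_measure (packages n s)))
           (\<lambda>k \<omega>. \<omega> k) n s"
proof -
  let ?U = "uniform_count_measure (packages n s)"
  let ?P = "PiM UNIV (\<lambda>_::nat. ?U)"
  have fin: "finite (packages n s)"
    by (rule finite_subset[of _ "Pow {1..n}"]) (auto simp: packages_def)
  have "{1..s} \<in> packages n s"
    using assms by (auto simp: packages_def)
  then have ne: "packages n s \<noteq> {}" by blast
  have pU: "prob_space ?U"
    using fin ne by (rule prob_space_uniform_count_measure)
  interpret U: product_prob_space "\<lambda>_::nat. ?U" UNIV
    by (simp add: product_prob_space_def product_sigma_finite_def product_prob_space_axioms_def
        pU prob_space_imp_sigma_finite)
  have sts: "sets (count_space (packages n s)) = sets ?U"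
    by (simp add: sets_uniform_count_measure)
  have comp: "distr ?P (count_space (packages n s)) (\<lambda>\<omega>. \<omega> k) = ?U" for k
    using U.PiM_component[of k] distr_cong[OF refl sts, of ?P "\<lambda>\<omega>. \<omega> k" "\<lambda>\<omega>. \<omega> k"] by simp
  have meas: "(\<lambda>\<omega>. \<omega> k) \<in> measurable ?P (count_space (packages n s))" for k
    by (subst measurable_cong_sets[OF refl sts]) (rule measurable_component_singleton, simp)
  have "U.P.indep_vars (\<lambda>_. count_space (packages n s)) (\<lambda>k \<omega>. \<omega> k) UNIV"
  proof (subst U.P.indep_vars_iff_distr_eq_PiM')
    have "distr ?P (PiM UNIV (\<lambda>_::nat. count_space (packages n s)))
            (\<lambda>x. \<lambda>i\<in>UNIV. x i) = distr ?P ?P (\<lambda>x. x)"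
      by (rule distr_cong[OF refl sets_PiM_cong]) (simp_all add: sets_uniform_count_measure restrict_def)
    then show "distr ?P (PiM UNIV (\<lambda>_::nat. count_space (packages n s))) (\<lambda>x. \<lambda>i\<in>UNIV. x i)
      = PiM UNIV (\<lambda>i. distr ?P (count_space (packages n s)) (\<lambda>\<omega>. \<omega> i))"
      by (simp add: comp)
  qed (use meas in auto)
  then have "U.P.indep_vars (\<lambda>_. count_space (packages n s)) (\<lambda>k \<omega>. \<omega> k) {1..}"
    by (rule U.P.indep_vars_subset) simp
  then show ?thesis
    using assms by unfold_locales (auto simp: comp)
qed

end

theory Submission
  imports Defs
begin

text \<open>If \<open>i\<close> coupons are missing and \<open>K\<close> of them are in the next package, then \<open>K\<close> is
  hypergeometric and \<open>H\<^sub>i - H\<^sub>i\<^sub>-\<^sub>K\<close> has expectation exactly \<open>d = H\<^sub>n - H\<^sub>n\<^sub>-\<^sub>s\<close> when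
  \<open>i \<ge> s\<close>, and between \<open>d - s\<^sup>3/n\<^sup>2\<close> and \<open>d\<close> when \<open>1 \<le> i < s\<close>. Hence the harmonic number of
  the number of missing coupons is almost a linear clock, and telescoping gives \<open>d E[Y] \<ge> H\<^sub>n\<close>.
  Adding the small potential \<open>(s\<^sup>2/n) min(i, s)\<close> compensates the deficit for \<open>i < s\<close> and gives
  \<open>d E[Y] \<le> H\<^sub>n + s\<^sup>3/n\<close>. Finally \<open>1/d = n/s - (s-1)/(2s) + O(1/n)\<close>.\<close>

section \<open>Averaging over a random package\<close>

text \<open>Each summand equals \<open>(m - j) choose (k - j)\<close> over the common denominator
  \<open>m choose k\<close>, and these numerators run along a diagonal of Pascal's triangle, adding
  up to \<open>Suc m choose k\<close>.\<close>

lemma sum_choose_ratio: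
  assumes "k \<le> m"
  shows "(\<Sum>j\<le>k. real (k choose j) / real (m choose j)) = (real m + 1) / (real m + 1 - real k)"
proof -
  have "real (k choose j) / real (m choose j) = real ((m - j) choose (k - j)) / real (m choose k)"
    if "j \<le> k" for j
  proof -
    have "real (m choose k) * real (k choose j) = real (m choose j) * real ((m - j) choose (k - j))"
      using choose_mult[OF that assms] by (metis of_nat_mult)
    moreover have "m choose k > 0" "m choose j > 0"
      using assms that by simp_all
    ultimately show ?thesis
      by (simp add: frac_eq_eq mult.commute)
  qed
  then have "(\<Sum>j\<le>k. real (k choose j) / real (m choose j))
      = (\<Sum>j\<le>k. real ((m - j) choose (k - j)) / real (m choose k))"
    by simp
  also have "\<dots> = real (\<Sum>j\<le>k. (m - j) choose (k - j)) / real (m choose k)"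
    by (simp add: sum_divide_distrib)
  also have "\<dots> = real (Suc m choose k) / real (m choose k)"
    by (simp only: sum_choose_diagonal[OF assms])
  also have "\<dots> = (real m + 1) / (real m + 1 - real k)"
  proof -
    have "Suc m * (m choose k) = (Suc m choose k) * (Suc m - k)"
      using binomial_absorb_comp[of "Suc m" k] by (simp add: mult.commute)
    then have "(real m + 1) * real (m choose k) = real (Suc m choose k) * (real m + 1 - real k)"
      using assms by (metis le_SucI of_nat_Suc of_nat_diff of_nat_mult add.commute)
    moreover have "m choose k > 0" using assms by simp
    ultimately show ?thesis
      using assms by (simp add: frac_eq_eq)
  qed
  finally show ?thesis .
qed

text \<open>Expanding the difference in falling factorials of \<open>k\<close> makes its expectation
  explicit when \<open>k\<close> is hypergeometric. The terms with \<open>k < r\<close> vanish, those with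
  \<open>i < r\<close> because of \<open>x / 0 = 0\<close>.\<close>

lemma harm_diff_eq_sum_choose:
  assumes "k \<le> i" "k \<le> l"
  shows "harm i - harm (i - k)
      = (\<Sum>r=1..l. real (k choose r) / (real r * real (i choose r)))"
  using assms
proof (induction k)
  case 0
  have "(\<Sum>r=1..l. real (0 choose r) / (real r * real (i choose r))) = 0"
    by (rule sum.neutral) (simp add: binomial_eq_0)
  then show ?case by simp
next
  case (Suc k)
  have "harm (i - k) = harm (i - Suc k) + 1 / (real i - real k)"
    using harm_Suc[of "i - Suc k", where ?'a = real] Suc.prems
    by (simp add: Suc_diff_Suc of_nat_diff inverse_eq_divide)
  \<comment> \<open>By Pascal's rule the right-hand sum grows by this amount when \<open>k\<close>
    becomes \<open>Suc k\<close>. Absorption,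
    \<open>r * (i choose r) = i * ((i - 1) choose (r - 1))\<close>, reduces it to
    \<open>sum_choose_ratio\<close> with \<open>m = i - 1\<close>.\<close>
  moreover have "1 / (real i - real k)
      = (\<Sum>r=1..l. real (k choose (r - 1)) / (real r * real (i choose r)))"
  proof -
    have "(\<Sum>r=1..l. real (k choose (r - 1)) / (real r * real (i choose r)))
        = (\<Sum>j<l. real (k choose j) / (real (Suc j) * real (i choose Suc j)))"
      by (rule sum.reindex_bij_witness[of _ Suc "\<lambda>r. r - 1"]) auto
    also have "\<dots> = (\<Sum>j\<le>k. real (k choose j) / (real (Suc j) * real (i choose Suc j)))"
      using Suc.prems by (intro sum.mono_neutral_right) auto
    also have "\<dots> = (\<Sum>j\<le>k. real (k choose j) / real ((i - 1) choose j)) / real i"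
      unfolding sum_divide_distrib
    proof (rule sum.cong)
      fix j
      have "Suc j * (i choose Suc j) = i * ((i - 1) choose j)"
        by (rule binomial_absorption)
      then have "real (Suc j) * real (i choose Suc j) = real i * real ((i - 1) choose j)"
        by (metis of_nat_mult)
      then show "real (k choose j) / (real (Suc j) * real (i choose Suc j))
          = real (k choose j) / real ((i - 1) choose j) / real i"
        by (simp add: mult.commute)
    qed simp
    also have "\<dots> = 1 / (real i - real k)"
      using Suc.prems sum_choose_ratio[of k "i - 1"] by (simp add: of_nat_diff)
    finally show ?thesis by simp
  qed
  moreover have "real (Suc k choose r) = real (k choose r) + real (k choose (r - 1))"
    if "r \<in> {1..l}" for r
    using that by (cases r) simp_all
  ultimately show ?case
    using Suc by (simp add: add_divide_distrib sum.distrib)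
qed

section \<open>Counting packages and their intersections with a fixed set\<close>

lemma finite_packages [simp, intro]: "finite (packages n s)"
  by (rule finite_subset[of _ "Pow {1..n}"]) (auto simp: packages_def)

lemma card_packages: "card (packages n s) = n choose s"
  unfolding packages_def using n_subsets[of "{1..n}" s] by simp

text \<open>Removing \<open>C\<close> maps these packages bijectively onto the subsets of
  \<open>{1..n} - C\<close> with \<open>s - card C\<close> elements.\<close>

lemma card_packages_superset:
  assumes "C \<subseteq> {1..n}" "card C \<le> s"
  shows "card {B \<in> packages n s. C \<subseteq> B} = (n - card C) choose (s - card C)"
proof -
  have finC: "finite C" using assms(1) finite_subset by blast
  have "bij_betw (\<lambda>B. B - C) {B \<in> packages n s. C \<subseteq> B}
      {D. D \<subseteq> {1..n} - C \<and> card D = s - card C}"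
  proof (rule bij_betw_byWitness[where f' = "\<lambda>D. D \<union> C"])
    show "(\<lambda>D. D \<union> C) ` {D. D \<subseteq> {1..n} - C \<and> card D = s - card C}
        \<subseteq> {B \<in> packages n s. C \<subseteq> B}"
    proof safe
      fix D assume D: "D \<subseteq> {1..n} - C" "card D = s - card C"
      then have "finite D" using finite_subset by blast
      then have "card (D \<union> C) = card D + card C"
        using D finC by (intro card_Un_disjoint) auto
      then show "D \<union> C \<in> packages n s"
        using D assms by (auto simp: packages_def)
    qed
  qed (use finC in \<open>auto simp: packages_def card_Diff_subset\<close>)
  then have "card {B \<in> packages n s. C \<subseteq> B} = card {D. D \<subseteq> {1..n} - C \<and> card D = s - card C}"
    by (rule bij_betw_same_card)
  also have "\<dots> = card ({1..n} - C) choose (s - card C)"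
    by (rule n_subsets) simp
  finally show ?thesis
    using assms finC by (simp add: card_Diff_subset)
qed

text \<open>Double counting of the pairs \<open>C \<subseteq> B\<close> with \<open>C\<close> an \<open>r\<close>-subset of \<open>A\<close>.\<close>

lemma sum_packages_choose_card_Int:
  assumes A: "A \<subseteq> {1..n}" and "r \<le> s" "s \<le> n"
  shows "(\<Sum>B\<in>packages n s. real (card (A \<inter> B) choose r))
      = real (card (packages n s)) * real (card A choose r) * real (s choose r) / real (n choose r)"
proof -
  have finA: "finite A" using A finite_subset by blast
  have "(\<Sum>B\<in>packages n s. card (A \<inter> B) choose r)
      = (\<Sum>B\<in>packages n s. \<Sum>C\<in>{C. C \<subseteq> A \<and> card C = r}. if C \<subseteq> B then 1 else 0)"
  proof (rule sum.cong)
    fix B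
    have "card (A \<inter> B) choose r = card {C. C \<subseteq> A \<inter> B \<and> card C = r}"
      by (rule n_subsets[symmetric]) (use finA in simp)
    also have "{C. C \<subseteq> A \<inter> B \<and> card C = r} = {C \<in> {C. C \<subseteq> A \<and> card C = r}. C \<subseteq> B}"
      by auto
    finally show "card (A \<inter> B) choose r
        = (\<Sum>C\<in>{C. C \<subseteq> A \<and> card C = r}. if C \<subseteq> B then 1 else 0)"
      using finA by (simp add: sum.If_cases Int_def)
  qed simp
  also have "\<dots> = (\<Sum>C\<in>{C. C \<subseteq> A \<and> card C = r}. \<Sum>B\<in>packages n s. if C \<subseteq> B then 1 else 0)"
    by (rule sum.swap)
  also have "\<dots> = (\<Sum>C\<in>{C. C \<subseteq> A \<and> card C = r}. (n - r) choose (s - r))"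
  proof (rule sum.cong)
    fix C assume "C \<in> {C. C \<subseteq> A \<and> card C = r}"
    then have "card {B \<in> packages n s. C \<subseteq> B} = (n - r) choose (s - r)"
      using card_packages_superset[of C n s] A assms(2) by auto
    then show "(\<Sum>B\<in>packages n s. if C \<subseteq> B then 1 else 0) = (n - r) choose (s - r)"
      by (simp add: sum.If_cases Int_def)
  qed simp
  also have "\<dots> = (card A choose r) * ((n - r) choose (s - r))"
    using finA by (simp add: n_subsets)
  finally have "(\<Sum>B\<in>packages n s. real (card (A \<inter> B) choose r))
      = real (card A choose r) * real ((n - r) choose (s - r))"
    by (metis (mono_tags, lifting) of_nat_mult of_nat_sum sum.cong)
  moreover have "real (n choose s) * real (s choose r) = real (n choose r) * real ((n - r) choose (s - r))"
    using choose_mult[OF assms(2,3)] by (metis of_nat_mult)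
  moreover have "n choose r > 0"
    using assms by simp
  ultimately show ?thesis
    by (simp add: card_packages field_simps)
qed

text \<open>The transition operator of the Markov chain of missing sets: the mean of
  \<open>f\<close> after one more uniform package when exactly the coupons in \<open>A\<close> are
  missing.\<close>

definition package_mean :: "nat \<Rightarrow> nat \<Rightarrow> (nat set \<Rightarrow> real) \<Rightarrow> nat set \<Rightarrow> real" where
  "package_mean n s f A = (\<Sum>B\<in>packages n s. f (A - B)) / real (card (packages n s))"

lemma package_mean_add:
  "package_mean n s (\<lambda>A. f A + g A) A = package_mean n s f A + package_mean n s g A"
  by (simp add: package_mean_def sum.distrib add_divide_distrib)

lemma package_mean_cmult:
  "package_mean n s (\<lambda>A. c * f A) A = c * package_mean n s f A"
  by (simp add: package_mean_def sum_distrib_left)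

lemma package_mean_mono:
  assumes "\<And>B. B \<in> packages n s \<Longrightarrow> f (A - B) \<le> g (A - B)"
  shows "package_mean n s f A \<le> package_mean n s g A"
  unfolding package_mean_def by (intro divide_right_mono sum_mono assms) simp_all

lemma package_mean_const [simp]:
  assumes "s \<le> n"
  shows "package_mean n s (\<lambda>_. c) A = c"
  using assms by (simp add: package_mean_def card_packages)

text \<open>In the expansion of the drop, double counting averages each
  \<open>card (A \<inter> B) choose r\<close> to a multiple of \<open>card A choose r\<close>, which
  cancels the denominator. So \<open>A\<close> only decides which \<open>r\<close>
  contribute.\<close>

lemma package_mean_harm_card:
  assumes A: "A \<subseteq> {1..n}" and "s \<le> n"
  shows "package_mean n s (\<lambda>A. harm (card A)) A
      = harm (card A) - (\<Sum>r=1..s. if r \<le> card A then real (s choose r) / (real r * real (n choose r)) else 0)"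
proof -
  have finA: "finite A" using A finite_subset by blast
  define N where "N = real (card (packages n s))"
  have N: "N > 0" using assms by (simp add: N_def card_packages)
  have "harm (card (A - B)) = harm (card A)
      - (\<Sum>r=1..s. real (card (A \<inter> B) choose r) / (real r * real (card A choose r)))"
    if "B \<in> packages n s" for B
  proof -
    have "finite B" using that finite_subset by (auto simp: packages_def)
    then have "card (A \<inter> B) \<le> s" using that by (auto simp: packages_def intro: card_mono)
    moreover have "card (A \<inter> B) \<le> card A" using finA by (intro card_mono) auto
    moreover have "card (A - B) = card A - card (A \<inter> B)"
      using finA by (intro card_Diff_subset_Int) auto
    \<comment> \<open>The upper limit \<open>s\<close> does not depend on \<open>B\<close>, so the
      sums over \<open>B\<close> and \<open>r\<close> can be swapped below.\<close>
    ultimately show ?thesis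
      using harm_diff_eq_sum_choose[of "card (A \<inter> B)" "card A" s] by simp
  qed
  then have "(\<Sum>B\<in>packages n s. harm (card (A - B)) :: real)
      = N * harm (card A) - (\<Sum>B\<in>packages n s. \<Sum>r=1..s.
          real (card (A \<inter> B) choose r) / (real r * real (card A choose r)))"
    by (simp add: sum_subtractf N_def)
  also have "(\<Sum>B\<in>packages n s. \<Sum>r=1..s.
          real (card (A \<inter> B) choose r) / (real r * real (card A choose r)))
      = (\<Sum>r=1..s. (\<Sum>B\<in>packages n s. real (card (A \<inter> B) choose r)) / (real r * real (card A choose r)))"
    by (subst sum.swap) (simp add: sum_divide_distrib)
  \<comment> \<open>For \<open>r > card A\<close> the denominator is 0, so the quotient is 0 by
    convention; hence the case distinction.\<close>
  also have "\<dots> = (\<Sum>r=1..s. N * (if r \<le> card A then real (s choose r) / (real r * real (n choose r)) else 0))"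
  proof (rule sum.cong)
    fix r assume "r \<in> {1..s}"
    then show "(\<Sum>B\<in>packages n s. real (card (A \<inter> B) choose r)) / (real r * real (card A choose r))
      = N * (if r \<le> card A then real (s choose r) / (real r * real (n choose r)) else 0)"
      using sum_packages_choose_card_Int[OF A _ assms(2), of r] by (simp add: N_def)
  qed simp
  finally show ?thesis
    using N by (simp add: package_mean_def N_def[symmetric] diff_divide_distrib flip: sum_distrib_left)
qed

lemma package_mean_card:
  assumes A: "A \<subseteq> {1..n}" and "1 \<le> s" "s \<le> n"
  shows "package_mean n s (\<lambda>A. real (card A)) A = real (card A) * (1 - real s / real n)"
proof -
  have finA: "finite A" using A finite_subset by blast
  have "real (card (A - B)) = real (card A) - real (card (A \<inter> B) choose 1)" for B
  proof -
    have "card (A - B) = card A - card (A \<inter> B)" "card (A \<inter> B) \<le> card A"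
      using finA by (auto intro: card_Diff_subset_Int card_mono)
    then show ?thesis by simp
  qed
  then have "(\<Sum>B\<in>packages n s. real (card (A - B)))
      = real (card (packages n s)) * real (card A) - (\<Sum>B\<in>packages n s. real (card (A \<inter> B) choose 1))"
    by (simp add: sum_subtractf)
  also have "\<dots> = real (card (packages n s)) * (real (card A) * (1 - real s / real n))"
    using sum_packages_choose_card_Int[OF A assms(2,3)] by (simp add: algebra_simps)
  finally show ?thesis
    using assms by (simp add: package_mean_def card_packages)
qed

section \<open>Two potentials\<close>

text \<open>The drop at the first draw, which is certain: all \<open>n\<close> coupons are missing
  and exactly \<open>s\<close> of them arrive.\<close>

definition harm_drop :: "nat \<Rightarrow> nat \<Rightarrow> real" where
  "harm_drop n s = harm n - harm (n - s)"

text \<open>For \<open>r \<le> s\<close> the ratio of the binomials is the product of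
  \<open>(s - j) / (n - j)\<close> over \<open>j < r\<close>, and every factor is at most
  \<open>s / n\<close>. Beyond \<open>s\<close> the left side is 0.\<close>

lemma choose_ratio_le_power:
  assumes "s \<le> n"
  shows "real (s choose r) * real n ^ r \<le> real s ^ r * real (n choose r)"
proof (induction r)
  case 0
  then show ?case by simp
next
  case (Suc r)
  show ?case
  proof (cases "r < s")
    case False
    then show ?thesis by (simp add: binomial_eq_0)
  next
    case True
    have *: "real (Suc r) * real (m choose Suc r) = (real m - real r) * real (m choose r)"
      if "r \<le> m" for m
      using binomial_absorption[of r m] binomial_absorb_comp[of m r] that
      by (metis of_nat_diff of_nat_mult)
    have "real (Suc r) * (real (s choose Suc r) * real n ^ Suc r)
        = ((real s - real r) * real n) * (real (s choose r) * real n ^ r)"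
      using arg_cong[OF *[of s], of "\<lambda>x. x * real n ^ Suc r"] True by (simp add: mult_ac)
    also have "\<dots> \<le> ((real n - real r) * real s) * (real s ^ r * real (n choose r))"
    proof (rule mult_mono[OF _ Suc])
      have "real r * real s \<le> real r * real n" using assms by (intro mult_left_mono) simp_all
      then show "(real s - real r) * real n \<le> (real n - real r) * real s"
        by (simp add: algebra_simps)
    qed (use True assms in auto)
    also have "\<dots> = real (Suc r) * (real s ^ Suc r * real (n choose Suc r))"
      using arg_cong[OF *[of n], of "\<lambda>x. x * real s ^ Suc r"] True assms by (simp add: mult_ac)
    finally show ?thesis
      by (subst (asm) mult_le_cancel_left_pos) simp_all
  qed
qed

text \<open>Bounds the terms of \<open>harm_drop\<close> that can be lost when fewer than
  \<open>s\<close> coupons are missing. The term \<open>r = 1\<close> survives for every nonempty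
  set, so all losses are of second order in \<open>s / n\<close>.\<close>

lemma choose_ratio_le_square:
  assumes "2 \<le> r" "r \<le> s" "s \<le> n"
  shows "real (s choose r) / (real r * real (n choose r)) \<le> (real s / real n)\<^sup>2"
proof -
  have pos: "real (n choose r) > 0" "real n > 0" using assms by auto
  have "real (s choose r) / (real r * real (n choose r)) \<le> real (s choose r) / real (n choose r)"
    using assms pos by (intro divide_left_mono) (auto simp: mult_le_cancel_right1)
  also have "\<dots> \<le> (real s / real n) ^ r"
    using choose_ratio_le_power[OF assms(3), of r] pos by (simp add: divide_simps power_divide)
  also have "\<dots> \<le> (real s / real n)\<^sup>2"
    using assms by (intro power_decreasing) auto
  finally show ?thesis .
qed

text \<open>Compared with \<open>harm_drop n s\<close>, the mean drop lacks exactly the nonnegative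
  terms with \<open>r > card A\<close>. There are at most \<open>s\<close> of them, each at most
  \<open>(s / n)^2\<close>, whence the correction \<open>s^3 / n^2\<close>.\<close>

lemma package_mean_harm_card_bounds:
  assumes A: "A \<subseteq> {1..n}" "A \<noteq> {}" and "s \<le> n"
  shows "package_mean n s (\<lambda>A. harm (card A)) A \<ge> harm (card A) - harm_drop n s"
    and "package_mean n s (\<lambda>A. harm (card A)) A
      \<le> harm (card A) - harm_drop n s + (if card A < s then real s ^ 3 / (real n)\<^sup>2 else 0)"
proof -
  define t where "t r = real (s choose r) / (real r * real (n choose r))" for r
  have d: "harm_drop n s = (\<Sum>r=1..s. t r)"
    unfolding harm_drop_def t_def using assms(3) by (intro harm_diff_eq_sum_choose) auto
  have m: "package_mean n s (\<lambda>A. harm (card A)) A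
      = harm (card A) - (\<Sum>r=1..s. if r \<le> card A then t r else 0)"
    unfolding t_def by (rule package_mean_harm_card[OF A(1) assms(3)])
  have "(\<Sum>r=1..s. if r \<le> card A then t r else 0) \<le> (\<Sum>r=1..s. t r)"
    by (rule sum_mono) (simp add: t_def)
  then show "package_mean n s (\<lambda>A. harm (card A)) A \<ge> harm (card A) - harm_drop n s"
    by (simp add: m d)
  have "card A \<ge> 1"
    using A finite_subset[OF A(1)] by (simp add: Suc_le_eq card_gt_0_iff)
  \<comment> \<open>A lost term has \<open>1 \<le> card A < r \<le> s\<close>, so
    \<open>r \<ge> 2\<close> and the quadratic bound applies.\<close>
  then have "t r \<le> (if r \<le> card A then t r else 0)
      + (if card A < s then (real s / real n)\<^sup>2 else 0)" if "r \<in> {1..s}" for r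
    using that assms(3) choose_ratio_le_square[of r s n] by (auto simp: t_def)
  then have "(\<Sum>r=1..s. t r) \<le> (\<Sum>r=1..s. (if r \<le> card A then t r else 0)
      + (if card A < s then (real s / real n)\<^sup>2 else 0))"
    by (rule sum_mono)
  also have "\<dots> = (\<Sum>r=1..s. if r \<le> card A then t r else 0)
      + (if card A < s then real s ^ 3 / (real n)\<^sup>2 else 0)"
    by (auto simp: sum.distrib power_divide power3_eq_cube power2_eq_square)
  finally show "package_mean n s (\<lambda>A. harm (card A)) A
      \<le> harm (card A) - harm_drop n s + (if card A < s then real s ^ 3 / (real n)\<^sup>2 else 0)"
    by (simp add: m d)
qed

text \<open>The second summand pays for the deficit of the first on sets of fewer than \<open>s\<close> coupons.\<close>

definition upper_potential :: "nat \<Rightarrow> nat \<Rightarrow> nat set \<Rightarrow> real" where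
  "upper_potential n s A = harm (card A) + (real s)\<^sup>2 / real n * real (min (card A) s)"

text \<open>For \<open>card A < s\<close> a draw removes on average
  \<open>card A * s / n \<ge> s / n\<close> coupons of \<open>A\<close>, and the weight
  \<open>s^2 / n\<close> turns this into \<open>s^3 / n^2\<close>, exactly the allowance for the
  harmonic part. For larger \<open>A\<close> the capped cardinality starts at its maximum
  \<open>s\<close>.\<close>

lemma package_mean_upper_potential:
  assumes A: "A \<subseteq> {1..n}" "A \<noteq> {}" and "1 \<le> s" "s \<le> n"
  shows "package_mean n s (upper_potential n s) A \<le> upper_potential n s A - harm_drop n s"
proof -
  have card: "card A \<ge> 1"
    using A finite_subset[OF A(1)] by (simp add: Suc_le_eq card_gt_0_iff)
  have "package_mean n s (\<lambda>A. real (min (card A) s)) A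
      \<le> real (min (card A) s) - (if card A < s then real s / real n else 0)"
  proof (cases "card A < s")
    case True
    have "package_mean n s (\<lambda>A. real (min (card A) s)) A \<le> package_mean n s (\<lambda>A. real (card A)) A"
      by (rule package_mean_mono) simp
    also have "\<dots> = real (card A) - real (card A) * (real s / real n)"
      using package_mean_card[OF A(1) assms(3,4)] by (simp add: algebra_simps)
    also have "\<dots> \<le> real (card A) - 1 * (real s / real n)"
      using card by (intro diff_left_mono mult_right_mono) auto
    finally show ?thesis using True by simp
  next
    case False
    have "package_mean n s (\<lambda>A. real (min (card A) s)) A \<le> package_mean n s (\<lambda>A. real s) A"
      by (rule package_mean_mono) simp
    then show ?thesis using False assms by simp
  qed
  then have "(real s)\<^sup>2 / real n * package_mean n s (\<lambda>A. real (min (card A) s)) A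
      \<le> (real s)\<^sup>2 / real n * (real (min (card A) s) - (if card A < s then real s / real n else 0))"
    by (rule mult_left_mono) simp
  also have "\<dots> = (real s)\<^sup>2 / real n * real (min (card A) s)
      - (if card A < s then real s ^ 3 / (real n)\<^sup>2 else 0)"
    by (simp add: right_diff_distrib power2_eq_square power3_eq_cube)
  finally have "(real s)\<^sup>2 / real n * package_mean n s (\<lambda>A. real (min (card A) s)) A \<le> \<dots>" .
  moreover have "package_mean n s (upper_potential n s) A = package_mean n s (\<lambda>A. harm (card A)) A
      + (real s)\<^sup>2 / real n * package_mean n s (\<lambda>A. real (min (card A) s)) A"
    unfolding upper_potential_def[abs_def] package_mean_add package_mean_cmult by simp
  ultimately show ?thesis
    using package_mean_harm_card_bounds(2)[OF A assms(4)] by (simp add: upper_potential_def)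
qed

section \<open>The coupons missing after \<open>m\<close> draws\<close>

context coupon_collector
begin

definition missing :: "nat \<Rightarrow> 'a \<Rightarrow> nat set" where
  "missing m \<omega> = {1..n} - (\<Union>k\<in>{1..m}. X k \<omega>)"

lemma missing_subset: "missing m \<omega> \<subseteq> {1..n}"
  by (auto simp: missing_def)

lemma missing_Suc: "missing (Suc m) \<omega> = missing m \<omega> - X (Suc m) \<omega>"
  by (auto simp: missing_def atLeastAtMostSuc_conv)

lemma measurable_draw: "k \<ge> 1 \<Longrightarrow> X k \<in> measurable M (count_space (packages n s))"
  using indep_draws by (auto simp: indep_vars_def)

text \<open>\<open>missing m\<close> is a function of the draws \<open>1..m\<close> alone, and these
  are jointly independent of draw \<open>Suc m\<close>. A finite product of finite discrete spaces
  is discrete, so every function on it is measurable.\<close>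

lemma indep_missing_draw:
  "indep_var (count_space UNIV) (missing m) (count_space UNIV) (X (Suc m))"
proof -
  let ?P = "\<lambda>_. count_space (packages n s)"
  have "indep_var (PiM {1..m} ?P) (\<lambda>\<omega>. restrict (\<lambda>i. X i \<omega>) {1..m})
      (PiM {Suc m} ?P) (\<lambda>\<omega>. restrict (\<lambda>i. X i \<omega>) {Suc m})"
    by (rule indep_var_restrict[OF indep_draws]) auto
  then have "indep_var (count_space UNIV)
      ((\<lambda>f. {1..n} - (\<Union>k\<in>{1..m}. f k)) \<circ> (\<lambda>\<omega>. restrict (\<lambda>i. X i \<omega>) {1..m}))
      (count_space UNIV) ((\<lambda>f. f (Suc m)) \<circ> (\<lambda>\<omega>. restrict (\<lambda>i. X i \<omega>) {Suc m}))"
    by (rule indep_var_compose) (simp_all add: count_space_PiM_finite countable_finite)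
  also have "(\<lambda>f. {1..n} - (\<Union>k\<in>{1..m}. f k)) \<circ> (\<lambda>\<omega>. restrict (\<lambda>i. X i \<omega>) {1..m}) = missing m"
    by (auto simp: fun_eq_iff missing_def)
  also have "(\<lambda>f. f (Suc m)) \<circ> (\<lambda>\<omega>. restrict (\<lambda>i. X i \<omega>) {Suc m}) = X (Suc m)"
    by (auto simp: fun_eq_iff)
  finally show ?thesis .
qed

lemma measurable_missing [measurable]: "missing m \<in> measurable M (count_space UNIV)"
  using indep_missing_draw[of m] by (rule indep_var_rv1)

text \<open>\<open>missing m\<close> has finitely many possible values, so any function of it is
  bounded.\<close>

lemma integrable_missing: "integrable M (\<lambda>\<omega>. f (missing m \<omega>) :: real)"
proof (rule integrable_const_bound[where B = "\<Sum>A\<in>Pow {1..n}. \<bar>f A\<bar>"])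
  have "\<bar>f (missing m \<omega>)\<bar> \<le> (\<Sum>A\<in>Pow {1..n}. \<bar>f A\<bar>)" for \<omega>
    using missing_subset[of m \<omega>] by (intro member_le_sum) auto
  then show "AE \<omega> in M. norm (f (missing m \<omega>)) \<le> (\<Sum>A\<in>Pow {1..n}. \<bar>f A\<bar>)"
    by simp
qed (rule measurable_compose[OF measurable_missing], simp)

lemma prob_draw:
  assumes "k \<ge> 1" "B \<in> packages n s"
  shows "prob {\<omega> \<in> space M. X k \<omega> = B} = 1 / real (card (packages n s))"
proof -
  have "prob {\<omega> \<in> space M. X k \<omega> = B} = prob (X k -` {B} \<inter> space M)"
    by (rule arg_cong[where f = prob]) auto
  also have "\<dots> = measure (distr M (count_space (packages n s)) (X k)) {B}"
    using assms measurable_draw by (subst measure_distr) auto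
  also have "\<dots> = 1 / real (card (packages n s))"
    using assms by (simp add: uniform_draws measure_uniform_count_measure)
  finally show ?thesis .
qed

text \<open>The Markov property for one step. Splitting by the value \<open>B\<close> of the next
  draw makes each summand a product of a function of \<open>missing m\<close> and the indicator
  \<open>D B\<close>, which are independent.\<close>

lemma expectation_missing_Suc:
  "expectation (\<lambda>\<omega>. f (missing (Suc m) \<omega>)) = expectation (\<lambda>\<omega>. package_mean n s f (missing m \<omega>))"
proof -
  define D where "D B \<omega> = (if X (Suc m) \<omega> = B then 1 else 0 :: real)" for B \<omega>
  have indep: "indep_var borel (\<lambda>\<omega>. f (missing m \<omega> - B)) borel (D B)" for B
    using indep_var_compose[OF indep_missing_draw[of m],
        of "\<lambda>A. f (A - B)" borel "\<lambda>C. if C = B then 1 else 0" borel]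
    by (simp add: comp_def D_def[abs_def])
  have D_meas: "D B \<in> borel_measurable M" for B
    using indep by (rule indep_var_rv2)
  have D_int: "integrable M (D B)" for B
    by (rule integrable_const_bound[where B = 1]) (auto simp: D_def intro: D_meas)
  have D_exp: "expectation (D B) = 1 / real (card (packages n s))" if "B \<in> packages n s" for B
  proof -
    have "expectation (D B) = expectation (indicator {\<omega> \<in> space M. X (Suc m) \<omega> = B})"
      by (intro Bochner_Integration.integral_cong) (auto simp: D_def)
    also have "\<dots> = prob ({\<omega> \<in> space M. X (Suc m) \<omega> = B} \<inter> space M)"
      by simp
    finally show ?thesis
      using prob_draw[OF _ that, of "Suc m"] by (simp add: Int_def conj_commute)
  qed
  have "expectation (\<lambda>\<omega>. f (missing (Suc m) \<omega>))
      = expectation (\<lambda>\<omega>. \<Sum>B\<in>packages n s. f (missing m \<omega> - B) * D B \<omega>)"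
  proof (rule Bochner_Integration.integral_cong)
    fix \<omega> assume "\<omega> \<in> space M"
    then have "X (Suc m) \<omega> \<in> packages n s"
      using measurable_space[OF measurable_draw[of "Suc m"]] by simp
    then show "f (missing (Suc m) \<omega>) = (\<Sum>B\<in>packages n s. f (missing m \<omega> - B) * D B \<omega>)"
      by (simp add: D_def missing_Suc if_distrib[of "\<lambda>x. _ * x"] sum.delta' cong: if_cong)
  qed simp
  also have "\<dots> = (\<Sum>B\<in>packages n s. expectation (\<lambda>\<omega>. f (missing m \<omega> - B) * D B \<omega>))"
    using indep_var_integrable[OF indep integrable_missing D_int]
    by (rule Bochner_Integration.integral_sum)
  also have "\<dots> = (\<Sum>B\<in>packages n s.
      expectation (\<lambda>\<omega>. f (missing m \<omega> - B)) * (1 / real (card (packages n s))))"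
    using indep_var_lebesgue_integral[OF indep integrable_missing D_int]
    by (intro sum.cong) (simp_all add: D_exp)
  also have "\<dots> = expectation (\<lambda>\<omega>. package_mean n s f (missing m \<omega>))"
    unfolding package_mean_def sum_divide_distrib
    by (subst Bochner_Integration.integral_sum)
      (simp_all add: integrable_missing[where f = "\<lambda>A. f (A - _) / _"])
  finally show ?thesis .
qed

section \<open>Tail probabilities and telescoping bounds for their sum\<close>

definition incomplete_prob :: "nat \<Rightarrow> real" where
  "incomplete_prob m = prob {\<omega> \<in> space M. missing m \<omega> \<noteq> {}}"

lemma incomplete_prob_eq_expectation:
  "incomplete_prob m = expectation (\<lambda>\<omega>. if missing m \<omega> \<noteq> {} then 1 else 0)"
proof -
  have "expectation (\<lambda>\<omega>. if missing m \<omega> \<noteq> {} then 1 else 0 :: real)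
      = expectation (indicator {\<omega> \<in> space M. missing m \<omega> \<noteq> {}})"
    by (intro Bochner_Integration.integral_cong) auto
  then show ?thesis
    by (simp add: incomplete_prob_def Int_def conj_commute)
qed

lemma harm_drop_pos: "harm_drop n s > 0"
proof -
  have "harm (Suc (n - s)) \<le> (harm n :: real)"
    using s_ge_1 s_less_n by (intro harm_mono) simp
  moreover have "(0::real) < inverse (of_nat (Suc (n - s)))"
    by (simp only: of_nat_0_less_iff positive_imp_inverse_positive)
  ultimately show ?thesis
    unfolding harm_drop_def harm_Suc by linarith
qed

text \<open>Each draw lowers the expected \<open>upper_potential\<close> by at least
  \<open>harm_drop n s\<close> times the probability that a coupon is still missing. The sum
  telescopes, and the final value is nonnegative.\<close>

lemma sum_incomplete_prob_le:
  "harm_drop n s * (\<Sum>m<N. incomplete_prob m) \<le> harm n + real s ^ 3 / real n"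
proof -
  let ?E = "\<lambda>m. expectation (\<lambda>\<omega>. upper_potential n s (missing m \<omega>))"
  have step: "harm_drop n s * incomplete_prob m \<le> ?E m - ?E (Suc m)" for m
  proof -
    have "?E (Suc m) = expectation (\<lambda>\<omega>. package_mean n s (upper_potential n s) (missing m \<omega>))"
      by (rule expectation_missing_Suc)
    also have "\<dots> \<le> expectation (\<lambda>\<omega>. upper_potential n s (missing m \<omega>)
        - harm_drop n s * (if missing m \<omega> \<noteq> {} then 1 else 0))"
    proof (rule integral_mono)
      show "integrable M (\<lambda>\<omega>. upper_potential n s (missing m \<omega>)
          - harm_drop n s * (if missing m \<omega> \<noteq> {} then 1 else 0))"
        by (rule integrable_missing)
      fix \<omega>
      \<comment> \<open>If nothing is missing, both sides are 0 and no drop is claimed.\<close>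
      show "package_mean n s (upper_potential n s) (missing m \<omega>)
          \<le> upper_potential n s (missing m \<omega>)
            - harm_drop n s * (if missing m \<omega> \<noteq> {} then 1 else 0)"
        using package_mean_upper_potential[OF missing_subset[of m \<omega>]] s_ge_1 s_less_n
        by (auto simp: package_mean_def upper_potential_def harm_expand)
    qed (rule integrable_missing)
    also have "\<dots> = ?E m - harm_drop n s * incomplete_prob m"
      unfolding incomplete_prob_eq_expectation
      by (subst Bochner_Integration.integral_diff)
        (rule integrable_missing integrable_mult_right | simp)+
    finally show ?thesis by simp
  qed
  have "harm_drop n s * (\<Sum>m<N. incomplete_prob m) \<le> (\<Sum>m<N. ?E m - ?E (Suc m))"
    unfolding sum_distrib_left by (intro sum_mono step)
  also have "\<dots> = ?E 0 - ?E N"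
    by (rule sum_lessThan_telescope')
  finally have "harm_drop n s * (\<Sum>m<N. incomplete_prob m) \<le> ?E 0 - ?E N" .
  moreover have "?E N \<ge> 0"
    by (intro Bochner_Integration.integral_nonneg) (simp add: upper_potential_def harm_nonneg)
  \<comment> \<open>Initially \<open>n\<close> coupons are missing and \<open>min n s = s\<close>,
    so the second summand starts at \<open>s^2 / n * s\<close>.\<close>
  moreover have "?E 0 = harm n + real s ^ 3 / real n"
    using s_less_n
    by (simp add: missing_def upper_potential_def prob_space power2_eq_square power3_eq_cube)
  ultimately show ?thesis by simp
qed

text \<open>The same telescoping with the harmonic number alone, whose mean drop is at most
  \<open>harm_drop n s\<close>. Its mean after \<open>N\<close> draws is at most
  \<open>harm n * incomplete_prob N\<close>, since it vanishes once the collection is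
  complete.\<close>

lemma sum_incomplete_prob_ge:
  "harm n * (1 - incomplete_prob N) \<le> harm_drop n s * (\<Sum>m<N. incomplete_prob m)"
proof -
  let ?E = "\<lambda>m. expectation (\<lambda>\<omega>. harm (card (missing m \<omega>)) :: real)"
  have step: "?E m - ?E (Suc m) \<le> harm_drop n s * incomplete_prob m" for m
  proof -
    have "?E m - harm_drop n s * incomplete_prob m = expectation (\<lambda>\<omega>. harm (card (missing m \<omega>))
        - harm_drop n s * (if missing m \<omega> \<noteq> {} then 1 else 0))"
      unfolding incomplete_prob_eq_expectation
      by (subst Bochner_Integration.integral_diff)
        (rule integrable_missing integrable_mult_right | simp)+
    also have "\<dots> \<le> expectation (\<lambda>\<omega>. package_mean n s (\<lambda>A. harm (card A)) (missing m \<omega>))"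
    proof (rule integral_mono)
      show "integrable M (\<lambda>\<omega>. harm (card (missing m \<omega>))
          - harm_drop n s * (if missing m \<omega> \<noteq> {} then 1 else 0))"
        by (rule integrable_missing)
      fix \<omega>
      show "harm (card (missing m \<omega>)) - harm_drop n s * (if missing m \<omega> \<noteq> {} then 1 else 0)
          \<le> package_mean n s (\<lambda>A. harm (card A)) (missing m \<omega>)"
        using package_mean_harm_card_bounds(1)[OF missing_subset[of m \<omega>]] s_less_n
        by (auto simp: package_mean_def harm_expand)
    qed (rule integrable_missing)
    also have "\<dots> = ?E (Suc m)"
      by (rule expectation_missing_Suc[symmetric])
    finally show ?thesis by simp
  qed
  have "?E N \<le> expectation (\<lambda>\<omega>. harm n * (if missing N \<omega> \<noteq> {} then 1 else 0))"
  proof (rule integral_mono)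
    fix \<omega>
    have "card (missing N \<omega>) \<le> n"
      using card_mono[OF _ missing_subset[of N \<omega>]] by simp
    then show "harm (card (missing N \<omega>)) \<le> (harm n * (if missing N \<omega> \<noteq> {} then 1 else 0) :: real)"
      by (auto intro: harm_mono simp: harm_expand)
  qed (rule integrable_missing)+
  also have "\<dots> = harm n * incomplete_prob N"
    unfolding incomplete_prob_eq_expectation by simp
  finally have "harm n * (1 - incomplete_prob N) \<le> ?E 0 - ?E N"
    by (simp add: missing_def prob_space algebra_simps)
  also have "\<dots> = (\<Sum>m<N. ?E m - ?E (Suc m))"
    by (rule sum_lessThan_telescope'[symmetric])
  also have "\<dots> \<le> harm_drop n s * (\<Sum>m<N. incomplete_prob m)"
    unfolding sum_distrib_left by (intro sum_mono step)
  finally show ?thesis .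
qed

text \<open>The upper bound holds for all partial sums. Summability also forces
  \<open>incomplete_prob N\<close> to tend to 0, which removes the remainder from the lower
  bound.\<close>

lemma summable_incomplete_prob: "summable incomplete_prob"
proof (rule bounded_imp_summable)
  show "incomplete_prob m \<ge> 0" for m
    by (simp add: incomplete_prob_def)
  show "(\<Sum>m\<le>N. incomplete_prob m) \<le> (harm n + real s ^ 3 / real n) / harm_drop n s" for N
    using sum_incomplete_prob_le[of "Suc N"] harm_drop_pos
    by (simp add: lessThan_Suc_atMost pos_le_divide_eq mult.commute)
qed

lemma suminf_incomplete_prob_bounds:
  "harm n / harm_drop n s \<le> suminf incomplete_prob"
  "suminf incomplete_prob \<le> (harm n + real s ^ 3 / real n) / harm_drop n s"
proof -
  have lim: "(\<lambda>N. harm_drop n s * (\<Sum>m<N. incomplete_prob m))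
      \<longlonglongrightarrow> harm_drop n s * suminf incomplete_prob"
    by (intro tendsto_mult_left summable_LIMSEQ summable_incomplete_prob)
  have "(\<lambda>N. harm n * (1 - incomplete_prob N)) \<longlonglongrightarrow> harm n * (1 - 0)"
    by (intro tendsto_intros summable_LIMSEQ_zero summable_incomplete_prob)
  then have "harm n \<le> harm_drop n s * suminf incomplete_prob"
    using LIMSEQ_le[OF _ lim] sum_incomplete_prob_ge by fastforce
  then show "harm n / harm_drop n s \<le> suminf incomplete_prob"
    using harm_drop_pos by (simp add: pos_divide_le_eq mult.commute)
  have "harm_drop n s * suminf incomplete_prob \<le> harm n + real s ^ 3 / real n"
    using LIMSEQ_le_const2[OF lim] sum_incomplete_prob_le by blast
  then show "suminf incomplete_prob \<le> (harm n + real s ^ 3 / real n) / harm_drop n s"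
    using harm_drop_pos by (simp add: pos_le_divide_eq mult.commute)
qed

section \<open>The expectation as a sum of tail probabilities\<close>

lemma less_draws_needed_iff:
  assumes "\<omega> \<in> space M"
  shows "enat t < draws_needed X n \<omega> \<longleftrightarrow> missing t \<omega> \<noteq> {}"
proof -
  have X: "X k \<omega> \<subseteq> {1..n}" if "k \<ge> 1" for k
    using measurable_space[OF measurable_draw[OF that] assms] by (auto simp: packages_def)
  \<comment> \<open>On \<open>space M\<close> every draw lies in \<open>{1..n}\<close>, so covering
    all coupons already gives equality.\<close>
  have complete: "(\<Union>k\<in>{1..m}. X k \<omega>) = {1..n} \<longleftrightarrow> missing m \<omega> = {}" for m
    using X by (fastforce simp: missing_def)
  have mono: "missing m \<omega> \<subseteq> missing m' \<omega>" if "m' \<le> m" for m m'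
    using that by (fastforce simp: missing_def)
  show ?thesis
  proof
    assume *: "enat t < draws_needed X n \<omega>"
    show "missing t \<omega> \<noteq> {}"
    proof
      assume complete_t: "missing t \<omega> = {}"
      have "draws_needed X n \<omega> \<le> enat t"
        unfolding draws_needed_def by (intro INF_lower CollectI) (simp only: complete complete_t)
      then show False using * by simp
    qed
  next
    assume *: "missing t \<omega> \<noteq> {}"
    \<comment> \<open>The strict bound is restated with the successor of \<open>t\<close>, a form
      that passes to the infimum, also when no \<open>m\<close> qualifies and the value is
      infinite.\<close>
    have "eSuc (enat t) \<le> draws_needed X n \<omega>"
      unfolding draws_needed_def
    proof (rule INF_greatest)
      fix m assume "m \<in> {m. (\<Union>k\<in>{1..m}. X k \<omega>) = {1..n}}"
      then have "missing m \<omega> = {}" by (simp only: mem_Collect_eq complete)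
      then have "t < m" using mono[of m t] * by (cases "t < m") auto
      then show "eSuc (enat t) \<le> enat m" by (simp add: eSuc_enat)
    qed
    then show "enat t < draws_needed X n \<omega>"
      by (simp add: Suc_ile_eq eSuc_enat)
  qed
qed

text \<open>An extended natural is determined by the naturals below it: of two distinct values the
  smaller is finite and separates them. So each level set is given by countably many conditions on
  the sets \<open>missing t\<close>.\<close>

lemma measurable_draws_needed: "draws_needed X n \<in> measurable M (count_space UNIV)"
proof -
  have enat_eqI: "x = y" if *: "\<forall>t. enat t < x \<longleftrightarrow> enat t < y" for x y :: enat
  proof (rule antisym; rule leI; rule notI)
    assume "y < x"
    then obtain t where "y = enat t" by (cases y) auto
    then show False using * \<open>y < x\<close> by blast
  next
    assume "x < y"
    then obtain t where "x = enat t" by (cases x) auto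
    then show False using * \<open>x < y\<close> by blast
  qed
  have "draws_needed X n -` {a} \<inter> space M \<in> sets M" for a
  proof -
    have "draws_needed X n \<omega> = a \<longleftrightarrow> (\<forall>t. missing t \<omega> \<noteq> {} \<longleftrightarrow> enat t < a)"
      if "\<omega> \<in> space M" for \<omega>
      unfolding less_draws_needed_iff[OF that, symmetric] by (blast intro: enat_eqI)
    then have "draws_needed X n -` {a} \<inter> space M
        = {\<omega> \<in> space M. \<forall>t. missing t \<omega> \<noteq> {} \<longleftrightarrow> enat t < a}"
      by blast
    also have "\<dots> \<in> sets M"
      by measurable
    finally show ?thesis .
  qed
  then show ?thesis
    by (simp add: measurable_count_space_eq2_countable)
qed

text \<open>Tail-sum formula: \<open>E[Y]\<close> is the sum of \<open>P(Y > t)\<close> over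
  \<open>t \<ge> 0\<close>, and \<open>Y > t\<close> means that a coupon is missing after
  \<open>t\<close> draws.\<close>

lemma expected_draws_eq_suminf: "expected_draws M X n = ennreal (suminf incomplete_prob)"
proof -
  have "expected_draws M X n = (\<Sum>t. emeasure M {\<omega> \<in> space M. enat t < draws_needed X n \<omega>})"
    unfolding expected_draws_def by (rule nn_integral_enat_function[OF measurable_draws_needed])
  also have "\<dots> = (\<Sum>t. ennreal (incomplete_prob t))"
    by (simp add: less_draws_needed_iff incomplete_prob_def emeasure_eq_measure cong: conj_cong)
  also have "\<dots> = ennreal (suminf incomplete_prob)"
    by (rule suminf_ennreal2) (simp_all add: summable_incomplete_prob, simp add: incomplete_prob_def)
  finally show ?thesis .
qed

lemma expected_draws_bounds:
  "harm n / harm_drop n s \<le> enn2real (expected_draws M X n)"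
  "enn2real (expected_draws M X n) \<le> (harm n + real s ^ 3 / real n) / harm_drop n s"
  using suminf_incomplete_prob_bounds suminf_nonneg[OF summable_incomplete_prob]
  by (simp_all add: expected_draws_eq_suminf incomplete_prob_def)

end

section \<open>Asymptotics\<close>

lemma harm_drop_eq_sum:
  assumes "s \<le> n"
  shows "harm_drop n s = (\<Sum>j<s. 1 / (real n - real j))"
  using assms
proof (induction s)
  case 0
  then show ?case by (simp add: harm_drop_def)
next
  case (Suc s)
  have "harm (n - s) = harm (n - Suc s) + 1 / (real n - real s)"
    using harm_Suc[of "n - Suc s", where ?'a = real] Suc.prems
    by (simp add: Suc_diff_Suc of_nat_diff inverse_eq_divide)
  then show ?case using Suc by (simp add: harm_drop_def)
qed

text \<open>Termwise, \<open>1/(n - j) = 1/n + j/n^2 + j^2/(n^2 (n - j))\<close>. From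
  \<open>2 * s \<le> n\<close> follows \<open>n - j \<ge> n/2\<close>, so each of the
  \<open>s\<close> remainders is at most \<open>2 s^2 / n^3\<close>.\<close>

lemma harm_drop_expansion:
  assumes "2 * s \<le> n" "1 \<le> s"
  shows "\<bar>harm_drop n s - (real s / real n + real s * (real s - 1) / (2 * (real n)\<^sup>2))\<bar>
      \<le> 2 * real s ^ 3 / real n ^ 3"
proof -
  have n: "real n > 0" using assms by simp
  have lin: "(\<Sum>j<s. 1 / real n + real j / (real n)\<^sup>2)
      = real s / real n + real s * (real s - 1) / (2 * (real n)\<^sup>2)"
  proof -
    have sum: "(\<Sum>j<t. real j) = real t * (real t - 1) / 2" for t
      by (induction t) (simp_all add: field_simps)
    show ?thesis
      unfolding sum.distrib sum_divide_distrib[symmetric] sum[of s] by simp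
  qed
  have term_bound: "\<bar>1 / (real n - real j) - (1 / real n + real j / (real n)\<^sup>2)\<bar>
      \<le> 2 * (real s)\<^sup>2 / real n ^ 3" if "j < s" for j
  proof -
    have j: "real n - real j \<ge> real n / 2" using that assms by simp
    then have pos: "real n - real j > 0" using n by linarith
    have eq: "1 / (real n - real j) - (1 / real n + real j / (real n)\<^sup>2)
        = (real j)\<^sup>2 / ((real n)\<^sup>2 * (real n - real j))"
      using n pos by (simp add: divide_simps) (simp add: algebra_simps power2_eq_square)
    have "\<bar>1 / (real n - real j) - (1 / real n + real j / (real n)\<^sup>2)\<bar>
        = (real j)\<^sup>2 / ((real n)\<^sup>2 * (real n - real j))"
      unfolding eq using pos by simp
    also have "\<dots> \<le> (real s)\<^sup>2 / ((real n)\<^sup>2 * (real n / 2))"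
      using n j that by (intro frac_le power_mono mult_left_mono) auto
    also have "\<dots> = 2 * (real s)\<^sup>2 / real n ^ 3"
      by (simp add: power2_eq_square power3_eq_cube)
    finally show ?thesis .
  qed
  have "harm_drop n s - (real s / real n + real s * (real s - 1) / (2 * (real n)\<^sup>2))
      = (\<Sum>j<s. 1 / (real n - real j) - (1 / real n + real j / (real n)\<^sup>2))"
    using harm_drop_eq_sum[of s n] assms lin by (simp add: sum_subtractf)
  also have "\<bar>\<dots>\<bar> \<le> (\<Sum>j<s. 2 * (real s)\<^sup>2 / real n ^ 3)"
    by (rule order.trans[OF sum_abs sum_mono]) (use term_bound in simp)
  also have "\<dots> = 2 * real s ^ 3 / real n ^ 3"
    by (simp add: power2_eq_square power3_eq_cube)
  finally show ?thesis .
qed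

lemma harm_le: "harm n \<le> real n"
  using sum_bounded_above[of "{1..n}" "\<lambda>k. inverse (real k)" 1]
  by (simp add: harm_def inverse_le_1_iff)

lemma harm_drop_ge:
  assumes "s < n"
  shows "harm_drop n s \<ge> real s / real n"
proof -
  have "(\<Sum>j<s. 1 / real n) \<le> (\<Sum>j<s. 1 / (real n - real j))"
    using assms by (intro sum_mono frac_le) auto
  then show ?thesis using harm_drop_eq_sum[of s n] assms by simp
qed

text \<open>Multiplying back replaces inverting a series: \<open>harm_drop n s\<close> times the
  proposed reciprocal \<open>c\<close> is 1 up to \<open>3 s^2 / n^2\<close>. With
  \<open>harm_drop n s \<ge> s / n\<close>, the crude bound \<open>harm n \<le> n\<close> then
  suffices for a constant error.\<close>

lemma harm_div_harm_drop_approx: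
  assumes "2 * s \<le> n" "1 \<le> s"
  shows "\<bar>harm n / harm_drop n s
      - (real n / real s * harm n - (real s - 1) / (2 * real s) * harm n)\<bar> \<le> 3 * real s"
proof -
  have n: "real n > 0" and s: "real s \<ge> 1" using assms by simp_all
  define c where "c = real n / real s - (real s - 1) / (2 * real s)"
  define R where "R = harm_drop n s - (real s / real n + real s * (real s - 1) / (2 * (real n)\<^sup>2))"
  have R: "\<bar>R\<bar> \<le> 2 * real s ^ 3 / real n ^ 3"
    unfolding R_def by (rule harm_drop_expansion[OF assms])
  have c: "0 \<le> c" "c \<le> real n / real s"
    using assms s by (simp_all add: c_def divide_simps)
  have "1 - harm_drop n s * c = (real s - 1)\<^sup>2 / (4 * (real n)\<^sup>2) - R * c"
  proof -
    \<comment> \<open>The contributions of order \<open>1 / n\<close> cancel, which is what fixes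
      the coefficient \<open>(s - 1) / (2 s)\<close>.\<close>
    have "(real s / real n + real s * (real s - 1) / (2 * (real n)\<^sup>2)) * c
        = 1 - (real s - 1)\<^sup>2 / (4 * (real n)\<^sup>2)"
      using n s by (simp add: c_def divide_simps) (simp add: algebra_simps power2_eq_square)
    then show ?thesis by (simp add: R_def algebra_simps)
  qed
  also have "\<bar>\<dots>\<bar> \<le> (real s - 1)\<^sup>2 / (4 * (real n)\<^sup>2) + \<bar>R\<bar> * c"
    using c by (intro order.trans[OF abs_triangle_ineq4]) (simp add: abs_mult)
  also have "\<dots> \<le> (real s)\<^sup>2 / (real n)\<^sup>2 + 2 * real s ^ 3 / real n ^ 3 * (real n / real s)"
    using n s c R by (intro add_mono mult_mono frac_le power_mono) auto
  also have "\<dots> = 3 * (real s)\<^sup>2 / (real n)\<^sup>2"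
    using n s by (simp add: power2_eq_square power3_eq_cube field_simps)
  finally have err: "\<bar>1 - harm_drop n s * c\<bar> \<le> 3 * (real s)\<^sup>2 / (real n)\<^sup>2" .
  have d: "harm_drop n s \<ge> real s / real n" "real s / real n > 0"
    using harm_drop_ge[of s n] assms n s by simp_all
  have "harm n / harm_drop n s - c * harm n = harm n * (1 - harm_drop n s * c) / harm_drop n s"
    using d by (simp add: field_simps)
  also have "\<bar>\<dots>\<bar> = harm n * \<bar>1 - harm_drop n s * c\<bar> / harm_drop n s"
    using d by (simp add: abs_mult)
  also have "\<dots> \<le> real n * (3 * (real s)\<^sup>2 / (real n)\<^sup>2) / (real s / real n)"
    using d err harm_le[of n] by (intro frac_le mult_mono) (auto simp: harm_nonneg)
  also have "\<dots> = 3 * real s"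
    using n s by (simp add: power2_eq_square field_simps)
  finally show ?thesis
    by (simp add: c_def algebra_simps)
qed

theorem theorem2p1:
  fixes s :: nat
    and M :: "nat \<Rightarrow> 'a measure"
    and X :: "nat \<Rightarrow> nat \<Rightarrow> 'a \<Rightarrow> nat set"
  assumes "s \<ge> 2"
    and "\<And>n. n > s \<Longrightarrow> coupon_collector (M n) (X n) n s"
  shows "(\<forall>n>s. expected_draws (M n) (X n) n < \<infinity>) \<and>
    (\<lambda>n. enn2real (expected_draws (M n) (X n) n)
         - (real n / real s * harm n - (real s - 1) / (2 * real s) * harm n)) \<in> O(\<lambda>_. 1)"
proof (intro conjI allI impI)
  fix n assume "n > s"
  then interpret coupon_collector "M n" "X n" n s by (rule assms(2))
  show "expected_draws (M n) (X n) n < \<infinity>"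
    by (simp add: expected_draws_eq_suminf)
next
  show "(\<lambda>n. enn2real (expected_draws (M n) (X n) n)
      - (real n / real s * harm n - (real s - 1) / (2 * real s) * harm n)) \<in> O(\<lambda>_. 1)"
  \<comment> \<open>\<open>3 s\<close> is the error of \<open>harm_div_harm_drop_approx\<close>, and
    \<open>s^2\<close> bounds \<open>s^3 / n\<close> divided by
    \<open>harm_drop n s \<ge> s / n\<close>.\<close>
  proof (rule bigoI[where c = "3 * real s + (real s)\<^sup>2"], rule eventually_sequentiallyI)
    fix n assume n: "n \<ge> 2 * s"
    then have "s < n" using assms(1) by simp
    then interpret coupon_collector "M n" "X n" n s by (rule assms(2))
    have "real s ^ 3 / real n / harm_drop n s \<le> real s ^ 3 / real n / (real s / real n)"
      using harm_drop_ge[OF \<open>s < n\<close>] assms(1) n by (intro frac_le) auto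
    also have "\<dots> = (real s)\<^sup>2"
      using assms(1) n by (simp add: power2_eq_square power3_eq_cube)
    finally have "real s ^ 3 / real n / harm_drop n s \<le> (real s)\<^sup>2" .
    then show "norm (enn2real (expected_draws (M n) (X n) n)
        - (real n / real s * harm n - (real s - 1) / (2 * real s) * harm n))
        \<le> (3 * real s + (real s)\<^sup>2) * norm (1::real)"
      using expected_draws_bounds harm_div_harm_drop_approx[of s n] n assms(1)
      by (simp add: add_divide_distrib abs_le_iff)
  qed
qed

end
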